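(* Let $\alpha>-1$, let $n$ be a positive integer, let $\psi$ be an analytic function on $\mathbb{D}$ that is not identically $0$, and let $\varphi$ be a nonconstant analytic self-map of $\mathbb{D}$. Suppose that $D_{\psi,\varphi,n}$ is bounded on $A_\alpha^2$. Then $D_{\psi,\varphi,n}$ is self-adjoint on $A_\alpha^2$ if and only if $$\psi(z)=\frac{az^n}{n!\,(1-\overline{c}z)^{n+\alpha+2}}=\frac{a}{t\,n!}K_c^{(n)}(z)\qquad\text{and}\qquad \varphi(z)=c+\frac{bz}{1-\overline{c}z}\qquad(z\in\mathbb{D}),$$ where $a=\psi^{(n)}(0)$ and $b=\varphi'(0)$ are both nonzero real numbers and $c=\varphi(0)$ belongs to $\mathbb{D}$. Furthermore, if $D_{\psi,\varphi,n}$ is self-adjoint (with $c=\varphi(0)$), then: (i) if $c=0$, then $D_{\psi,\varphi,n}$ is $J$-symmetric; (ii) if $c\neq0$, then $D_{\psi,\varphi,n}$ is $C_{e^{-2i\theta}z}J$-symmetric, where $\theta=\mathrm{Arg}(c)$.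
   Context: $\mathbb{D}$ is the open unit disk in $\mathbb{C}$. For $\alpha>-1$, the weighted Bergman space $A_\alpha^2$ is the Hilbert space of analytic functions $f(z)=\sum_{j\ge0}a_jz^j$ on $\mathbb{D}$ with $\|f\|^2=\sum_{j\ge0}|a_j|^2\beta(j)^2<\infty$, where $\beta(j)^2=\frac{j!\,\Gamma(\alpha+2)}{\Gamma(j+\alpha+2)}$, with inner product $\langle\sum a_jz^j,\sum b_jz^j\rangle=\sum a_j\overline{b_j}\beta(j)^2$. For $w\in\mathbb{D}$ and an integer $m\ge0$, $K_w^{(m)}\in A_\alpha^2$ is the function with $\langle f,K_w^{(m)}\rangle=f^{(m)}(w)$ for all $f\in A_\alpha^2$; explicitly $K_w^{(m)}(z)=\frac{(\alpha+2)\cdots(\alpha+m+1)z^m}{(1-\overline{w}z)^{m+\alpha+2}}$. Non-integer powers use the principal branch. Put $t=(\alpha+2)(\alpha+3)\cdots(\alpha+n+1)$. The weighted composition--differentiation operator of order $n$ is $D_{\psi,\varphi,n}f=\psi\cdot(f^{(n)}\circ\varphi)$. For $|\lambda|=1$, $C_{\lambda z}$ is the composition operator $(C_{\lambda z}f)(z)=f(\lambda z)$. A conjugation on a complex Hilbert space is an antilinear isometric involution $C$; a bounded operator $T$ is $C$-symmetric if $CT^*C=T$. $J$ is the conjugation $(Jf)(z)=\overline{f(\overline{z})}$; $C_{\lambda z}J$ is also a conjugation for $|\lambda|=1$. $\mathrm{Arg}(c)\in[0,2\pi)$ is the argument of $c$, so $c=|c|e^{i\,\mathrm{Arg}(c)}$.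 *)

theory Defs
  imports "HOL-Complex_Analysis.Complex_Analysis"
begin

definition bergman_weight :: "real \<Rightarrow> nat \<Rightarrow> real" where
  "bergman_weight \<alpha> j = fact j * Gamma (\<alpha> + 2) / Gamma (real j + \<alpha> + 2)"

definition taylor_coeff :: "(complex \<Rightarrow> complex) \<Rightarrow> nat \<Rightarrow> complex" where
  "taylor_coeff f j = (deriv ^^ j) f 0 / fact j"

text \<open>
  A function on the unit disk is represented by its extension by \<open>0\<close> to the whole plane, so that
  equality of elements of the space is equality in HOL.
\<close>

definition bergman_space :: "real \<Rightarrow> (complex \<Rightarrow> complex) set" where
  "bergman_space \<alpha> = {f. f holomorphic_on ball 0 1 \<and> (\<forall>z. z \<notin> ball 0 1 \<longrightarrow> f z = 0) \<and>
     summable (\<lambda>j. (cmod (taylor_coeff f j))\<^sup>2 * bergman_weight \<alpha> j)}"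

definition bergman_norm :: "real \<Rightarrow> (complex \<Rightarrow> complex) \<Rightarrow> real" where
  "bergman_norm \<alpha> f = sqrt (\<Sum>j. (cmod (taylor_coeff f j))\<^sup>2 * bergman_weight \<alpha> j)"

definition bergman_inner :: "real \<Rightarrow> (complex \<Rightarrow> complex) \<Rightarrow> (complex \<Rightarrow> complex) \<Rightarrow> complex" where
  "bergman_inner \<alpha> f g =
     (\<Sum>j. taylor_coeff f j * cnj (taylor_coeff g j) * of_real (bergman_weight \<alpha> j))"

definition bergman_kernel :: "real \<Rightarrow> complex \<Rightarrow> nat \<Rightarrow> complex \<Rightarrow> complex" where
  "bergman_kernel \<alpha> w m =
     (THE K. K \<in> bergman_space \<alpha> \<and>
        (\<forall>f\<in>bergman_space \<alpha>. bergman_inner \<alpha> f K = (deriv ^^ m) f w))"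

type_synonym operator = "(complex \<Rightarrow> complex) \<Rightarrow> (complex \<Rightarrow> complex)"

definition bounded_operator :: "real \<Rightarrow> operator \<Rightarrow> bool" where
  "bounded_operator \<alpha> T \<longleftrightarrow>
     (\<forall>f\<in>bergman_space \<alpha>. T f \<in> bergman_space \<alpha>) \<and>
     (\<forall>f\<in>bergman_space \<alpha>. \<forall>g\<in>bergman_space \<alpha>. \<forall>p q.
        T (\<lambda>z. p * f z + q * g z) = (\<lambda>z. p * T f z + q * T g z)) \<and>
     (\<exists>M. \<forall>f\<in>bergman_space \<alpha>. bergman_norm \<alpha> (T f) \<le> M * bergman_norm \<alpha> f)"

text \<open>\<open>S\<close> is the adjoint of \<open>T\<close>; the values of such an \<open>S\<close> on the space are unique.\<close>

definition is_adjoint :: "real \<Rightarrow> operator \<Rightarrow> operator \<Rightarrow> bool" where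
  "is_adjoint \<alpha> T S \<longleftrightarrow>
     (\<forall>g\<in>bergman_space \<alpha>. S g \<in> bergman_space \<alpha>) \<and>
     (\<forall>f\<in>bergman_space \<alpha>. \<forall>g\<in>bergman_space \<alpha>.
        bergman_inner \<alpha> (T f) g = bergman_inner \<alpha> f (S g))"

definition self_adjoint :: "real \<Rightarrow> operator \<Rightarrow> bool" where
  "self_adjoint \<alpha> T \<longleftrightarrow> bounded_operator \<alpha> T \<and> is_adjoint \<alpha> T T"

definition conjugation :: "real \<Rightarrow> operator \<Rightarrow> bool" where
  "conjugation \<alpha> C \<longleftrightarrow>
     (\<forall>f\<in>bergman_space \<alpha>. C f \<in> bergman_space \<alpha>) \<and>
     (\<forall>f\<in>bergman_space \<alpha>. \<forall>g\<in>bergman_space \<alpha>. \<forall>p q.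
        C (\<lambda>z. p * f z + q * g z) = (\<lambda>z. cnj p * C f z + cnj q * C g z)) \<and>
     (\<forall>f\<in>bergman_space \<alpha>. bergman_norm \<alpha> (C f) = bergman_norm \<alpha> f) \<and>
     (\<forall>f\<in>bergman_space \<alpha>. C (C f) = f)"

definition C_symmetric :: "real \<Rightarrow> operator \<Rightarrow> operator \<Rightarrow> bool" where
  "C_symmetric \<alpha> C T \<longleftrightarrow>
     conjugation \<alpha> C \<and> bounded_operator \<alpha> T \<and>
     (\<exists>S. is_adjoint \<alpha> T S \<and> (\<forall>f\<in>bergman_space \<alpha>. C (S (C f)) = T f))"

definition comp_diff_op :: "(complex \<Rightarrow> complex) \<Rightarrow> (complex \<Rightarrow> complex) \<Rightarrow> nat \<Rightarrow> operator" where
  "comp_diff_op \<psi> \<phi> n f =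
     (\<lambda>z. if z \<in> ball 0 1 then \<psi> z * (deriv ^^ n) f (\<phi> z) else 0)"

definition rotation_op :: "complex \<Rightarrow> operator" where
  "rotation_op \<mu> f = (\<lambda>z. f (\<mu> * z))"

definition J_op :: operator where
  "J_op f = (\<lambda>z. cnj (f (cnj z)))"

end

theory Submission
  imports Defs
begin

text \<open>
  Testing self-adjointness on the reproducing kernels \<open>K\<^sub>w\<close> gives the functional equation
  \<open>\<psi> w * cnj z ^ n / (1 - cnj z * \<phi> w) powr s = cnj (\<psi> z) * w ^ n / (1 - cnj (\<phi> z) * w) powr s\<close>
  with \<open>s = n + \<alpha> + 2\<close>. Dividing by \<open>w\<^sup>n\<close> and letting \<open>w\<close> tend
  to \<open>0\<close> determines \<open>\<psi>\<close>; differentiating in \<open>w\<close> at \<open>0\<close> then determines \<open>\<phi>\<close>, which avoids taking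
  \<open>s\<close>-th roots. Conversely the functional equation says that \<open>\<langle>Tf, K\<^sub>w\<rangle> = \<langle>f, T K\<^sub>w\<rangle>\<close>; expanding \<open>K\<^sub>w\<close>
  in monomials and comparing coefficients of powers of \<open>w\<close> yields \<open>\<langle>Tf, z\<^sup>j\<rangle> = \<langle>f, T z\<^sup>j\<rangle>\<close>,
  and boundedness extends this to the whole space.
\<close>

section \<open>Taylor expansions on the unit disk\<close>

lemma taylor_coeff_eqI:
  assumes "\<And>z. z \<in> ball 0 1 \<Longrightarrow> (\<lambda>j. c j * z ^ j) sums f z"
  shows "taylor_coeff f j = c j"
proof -
  have "f has_fps_expansion Abs_fps c"
    using assms by (intro has_fps_expansionI eventually_nhds_in_open[THEN eventually_mono, of "ball 0 1"]) auto
  from fps_nth_fps_expansion[OF this, of j] show ?thesis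
    by (simp add: taylor_coeff_def)
qed

lemma taylor_coeff_sums:
  assumes "f holomorphic_on ball 0 1" "z \<in> ball 0 1"
  shows "(\<lambda>j. taylor_coeff f j * z ^ j) sums f z"
  using holomorphic_power_series[OF assms] by (simp add: taylor_coeff_def)

text \<open>The \<open>i\<close>-th derivative of \<open>(deriv ^^ m) f\<close> at 0 is the
  \<open>(i + m)\<close>-th derivative of \<open>f\<close>; the factor
  \<open>fact (i + m) / fact i\<close> only exchanges the normalizing factorials.\<close>

lemma higher_deriv_taylor_sums:
  assumes "f holomorphic_on ball 0 1" "z \<in> ball 0 1"
  shows "(\<lambda>i. taylor_coeff f (i + m) * (fact (i + m) / fact i) * z ^ i) sums (deriv ^^ m) f z"
proof -
  have "(deriv ^^ m) f holomorphic_on ball 0 1"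
    using assms by (intro holomorphic_higher_deriv) auto
  from taylor_coeff_sums[OF this assms(2)] show ?thesis
    by (simp add: taylor_coeff_def funpow_add)
qed

lemma taylor_coeff_lincomb:
  assumes "f holomorphic_on ball 0 1" "g holomorphic_on ball 0 1"
  shows "taylor_coeff (\<lambda>z. p * f z + q * g z) j = p * taylor_coeff f j + q * taylor_coeff g j"
proof (rule taylor_coeff_eqI)
  fix z :: complex assume "z \<in> ball 0 1"
  then have "(\<lambda>j. p * (taylor_coeff f j * z ^ j) + q * (taylor_coeff g j * z ^ j)) sums (p * f z + q * g z)"
    using assms by (intro sums_add sums_mult taylor_coeff_sums)
  then show "(\<lambda>j. (p * taylor_coeff f j + q * taylor_coeff g j) * z ^ j) sums (p * f z + q * g z)"
    by (simp add: algebra_simps)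
qed

lemma bergman_space_holomorphic: "f \<in> bergman_space \<alpha> \<Longrightarrow> f holomorphic_on ball 0 1"
  by (simp add: bergman_space_def)

lemma bergman_space_outside: "f \<in> bergman_space \<alpha> \<Longrightarrow> z \<notin> ball 0 1 \<Longrightarrow> f z = 0"
  by (simp add: bergman_space_def)

lemma bergman_space_summable:
  "f \<in> bergman_space \<alpha> \<Longrightarrow> summable (\<lambda>j. (cmod (taylor_coeff f j))\<^sup>2 * bergman_weight \<alpha> j)"
  by (simp add: bergman_space_def)

lemma bergman_space_eqI:
  assumes "f \<in> bergman_space \<alpha>" "g \<in> bergman_space \<alpha>" "\<And>j. taylor_coeff f j = taylor_coeff g j"
  shows "f = g"
proof
  fix z
  show "f z = g z"
  proof (cases "z \<in> ball 0 1")
    case True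
    have "(\<lambda>j. taylor_coeff f j * z ^ j) sums f z" "(\<lambda>j. taylor_coeff g j * z ^ j) sums g z"
      using True assms(1,2) by (auto intro!: taylor_coeff_sums simp: bergman_space_holomorphic)
    then show ?thesis unfolding assms(3) by (rule sums_unique2)
  qed (metis assms(1,2) bergman_space_outside)
qed

lemma norm_cnj_mult_less_1: "w \<in> ball 0 1 \<Longrightarrow> z \<in> ball 0 1 \<Longrightarrow> cmod (cnj w * z) < 1"
  using mult_strict_mono'[of "cmod w" 1 "cmod z" 1] by (simp add: norm_mult)

section \<open>The weighted Bergman space and its reproducing kernels\<close>

locale weighted_bergman =
  fixes \<alpha> :: real
  assumes alpha: "\<alpha> > -1"
begin

lemma pochhammer_alpha_pos: "pochhammer (\<alpha> + 2) j > 0"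
  using alpha by (intro pochhammer_pos) simp

text \<open>As \<alpha> + 2 is positive, the Gamma quotient collapses to a Pochhammer symbol. In
  this form the weight cancels against the kernel coefficients.\<close>

lemma weight_eq: "bergman_weight \<alpha> j = fact j / pochhammer (\<alpha> + 2) j"
proof -
  have "\<alpha> + 2 \<notin> \<int>\<^sub>\<le>\<^sub>0" using alpha by (auto elim!: nonpos_Ints_cases)
  from pochhammer_Gamma[OF this, of j] show ?thesis
    by (simp add: bergman_weight_def add_ac)
qed

lemma weight_pos: "bergman_weight \<alpha> j > 0"
  using pochhammer_alpha_pos[of j] by (simp add: weight_eq)

lemma weight_nonneg [simp]: "bergman_weight \<alpha> j \<ge> 0"
  using weight_pos[of j] by simp

lemma weight_nonzero [simp]: "bergman_weight \<alpha> j \<noteq> 0"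
  using weight_pos[of j] by simp

text \<open>The two-term shape matches the linearity clauses of \<open>bounded_operator\<close> and
  \<open>conjugation\<close>. Summability rests on |x + y|^2 being at most 2|x|^2 + 2|y|^2.\<close>

lemma lincomb_in_space:
  assumes f: "f \<in> bergman_space \<alpha>" and g: "g \<in> bergman_space \<alpha>"
  shows "(\<lambda>z. p * f z + q * g z) \<in> bergman_space \<alpha>"
proof -
  let ?s = "\<lambda>h j. (cmod (taylor_coeff h j))\<^sup>2 * bergman_weight \<alpha> j"
  have "summable (\<lambda>j. 2 * (cmod p)\<^sup>2 * ?s f j + 2 * (cmod q)\<^sup>2 * ?s g j)"
    using f g by (intro summable_add summable_mult bergman_space_summable)
  then have "summable (?s (\<lambda>z. p * f z + q * g z))"
  proof (rule summable_comparison_test')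
    fix j :: nat
    let ?x = "p * taylor_coeff f j" and ?y = "q * taylor_coeff g j"
    have "(cmod (?x + ?y))\<^sup>2 \<le> (cmod ?x + cmod ?y)\<^sup>2"
      by (intro power_mono norm_triangle_ineq) auto
    also have "\<dots> \<le> 2 * (cmod ?x)\<^sup>2 + 2 * (cmod ?y)\<^sup>2"
      using zero_le_power2[of "cmod ?x - cmod ?y"] by (simp add: power2_sum power2_diff)
    finally have "(cmod (?x + ?y))\<^sup>2 * bergman_weight \<alpha> j
        \<le> (2 * (cmod ?x)\<^sup>2 + 2 * (cmod ?y)\<^sup>2) * bergman_weight \<alpha> j"
      by (intro mult_right_mono) auto
    then show "norm (?s (\<lambda>z. p * f z + q * g z) j)
        \<le> 2 * (cmod p)\<^sup>2 * ?s f j + 2 * (cmod q)\<^sup>2 * ?s g j"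
      using f g by (simp add: taylor_coeff_lincomb bergman_space_holomorphic norm_mult
          power_mult_distrib algebra_simps)
  qed
  then show ?thesis
    using f g by (auto simp: bergman_space_def intro!: holomorphic_intros)
qed

section \<open>The inner product and the Cauchy-Schwarz inequality\<close>

lemma inner_summable:
  assumes f: "f \<in> bergman_space \<alpha>" and g: "g \<in> bergman_space \<alpha>"
  shows "summable (\<lambda>j. taylor_coeff f j * cnj (taylor_coeff g j) * of_real (bergman_weight \<alpha> j))"
proof -
  let ?s = "\<lambda>h j. (cmod (taylor_coeff h j))\<^sup>2 * bergman_weight \<alpha> j"
  have "summable (\<lambda>j. ?s f j + ?s g j)"
    using f g by (intro summable_add bergman_space_summable)
  then show ?thesis
  proof (rule summable_comparison_test')
    fix j :: nat
    let ?x = "cmod (taylor_coeff f j)" and ?y = "cmod (taylor_coeff g j)"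
    have "2 * (?x * ?y) \<le> ?x\<^sup>2 + ?y\<^sup>2"
      using zero_le_power2[of "?x - ?y"] by (simp add: power2_diff)
    moreover have "0 \<le> ?x * ?y" by simp
    ultimately have "?x * ?y \<le> ?x\<^sup>2 + ?y\<^sup>2" by linarith
    then have "?x * ?y * bergman_weight \<alpha> j \<le> (?x\<^sup>2 + ?y\<^sup>2) * bergman_weight \<alpha> j"
      by (intro mult_right_mono) auto
    then show "cmod (taylor_coeff f j * cnj (taylor_coeff g j) * of_real (bergman_weight \<alpha> j)) \<le> ?s f j + ?s g j"
      by (simp add: norm_mult algebra_simps)
  qed
qed

lemma inner_sums:
  assumes "f \<in> bergman_space \<alpha>" "g \<in> bergman_space \<alpha>"
  shows "(\<lambda>j. taylor_coeff f j * cnj (taylor_coeff g j) * of_real (bergman_weight \<alpha> j))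
    sums bergman_inner \<alpha> f g"
  using inner_summable[OF assms] by (simp add: bergman_inner_def summable_sums)

lemma inner_commute:
  assumes "f \<in> bergman_space \<alpha>" "g \<in> bergman_space \<alpha>"
  shows "bergman_inner \<alpha> g f = cnj (bergman_inner \<alpha> f g)"
proof -
  have "(\<lambda>j. taylor_coeff g j * cnj (taylor_coeff f j) * of_real (bergman_weight \<alpha> j))
    sums cnj (bergman_inner \<alpha> f g)"
    using sums_cnj[THEN iffD2, OF inner_sums[OF assms]] by (simp add: mult_ac)
  then show ?thesis
    using inner_sums[OF assms(2,1)] sums_unique2 by blast
qed

lemma inner_lincomb_right:
  assumes f: "f \<in> bergman_space \<alpha>" and g: "g \<in> bergman_space \<alpha>" "h \<in> bergman_space \<alpha>"
  shows "bergman_inner \<alpha> f (\<lambda>z. p * g z + q * h z)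
    = cnj p * bergman_inner \<alpha> f g + cnj q * bergman_inner \<alpha> f h"
proof -
  have "(\<lambda>j. cnj p * (taylor_coeff f j * cnj (taylor_coeff g j) * of_real (bergman_weight \<alpha> j))
      + cnj q * (taylor_coeff f j * cnj (taylor_coeff h j) * of_real (bergman_weight \<alpha> j)))
    sums (cnj p * bergman_inner \<alpha> f g + cnj q * bergman_inner \<alpha> f h)"
    using assms by (intro sums_add sums_mult inner_sums)
  also have "(\<lambda>j. cnj p * (taylor_coeff f j * cnj (taylor_coeff g j) * of_real (bergman_weight \<alpha> j))
      + cnj q * (taylor_coeff f j * cnj (taylor_coeff h j) * of_real (bergman_weight \<alpha> j)))
    = (\<lambda>j. taylor_coeff f j * cnj (taylor_coeff (\<lambda>z. p * g z + q * h z) j) * of_real (bergman_weight \<alpha> j))"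
    using g by (simp add: taylor_coeff_lincomb bergman_space_holomorphic algebra_simps)
  finally show ?thesis
    using inner_sums[OF f lincomb_in_space[OF g]] sums_unique2 by blast
qed

text \<open>Splitting the weight as a product of two square roots turns truncations of the norm into
  Euclidean norms, so that the finite Cauchy-Schwarz inequality for \<open>L2_set\<close> applies to
  every partial sum of the inner product.\<close>

lemma L2_set_le_bergman_norm:
  assumes "f \<in> bergman_space \<alpha>"
  shows "L2_set (\<lambda>j. cmod (taylor_coeff f j) * sqrt (bergman_weight \<alpha> j)) {..<N} \<le> bergman_norm \<alpha> f"
  unfolding L2_set_def bergman_norm_def
  using assms by (auto simp: power_mult_distrib intro!: sum_le_suminf bergman_space_summable)

lemma inner_Cauchy_Schwarz:
  assumes f: "f \<in> bergman_space \<alpha>" and g: "g \<in> bergman_space \<alpha>"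
  shows "cmod (bergman_inner \<alpha> f g) \<le> bergman_norm \<alpha> f * bergman_norm \<alpha> g"
proof -
  let ?t = "\<lambda>j. taylor_coeff f j * cnj (taylor_coeff g j) * of_real (bergman_weight \<alpha> j)"
  let ?u = "\<lambda>h j. cmod (taylor_coeff h j) * sqrt (bergman_weight \<alpha> j)"
  have "(\<lambda>N. cmod (\<Sum>j<N. ?t j)) \<longlonglongrightarrow> cmod (bergman_inner \<alpha> f g)"
    using inner_sums[OF f g] unfolding sums_def by (rule tendsto_norm)
  moreover have "cmod (\<Sum>j<N. ?t j) \<le> bergman_norm \<alpha> f * bergman_norm \<alpha> g" for N
  proof -
    have "cmod (\<Sum>j<N. ?t j) \<le> (\<Sum>j<N. cmod (?t j))"
      by (rule norm_sum)
    also have "\<dots> = (\<Sum>j<N. \<bar>?u f j\<bar> * \<bar>?u g j\<bar>)"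
    proof (rule sum.cong[OF refl])
      fix j
      have "sqrt (bergman_weight \<alpha> j) * sqrt (bergman_weight \<alpha> j) = bergman_weight \<alpha> j"
        by simp
      then show "cmod (?t j) = \<bar>?u f j\<bar> * \<bar>?u g j\<bar>"
        by (simp add: norm_mult abs_mult mult_ac)
    qed
    also have "\<dots> \<le> L2_set (?u f) {..<N} * L2_set (?u g) {..<N}"
      by (rule L2_set_mult_ineq)
    also have "\<dots> \<le> bergman_norm \<alpha> f * bergman_norm \<alpha> g"
      using f g by (intro mult_mono L2_set_le_bergman_norm L2_set_nonneg order.trans[OF L2_set_nonneg L2_set_le_bergman_norm])
    finally show ?thesis .
  qed
  ultimately show ?thesis
    by (intro tendsto_upperbound[OF _ always_eventually]) auto
qed

section \<open>Monomials, Taylor polynomials and their density\<close>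

definition monomial :: "nat \<Rightarrow> complex \<Rightarrow> complex" where
  "monomial j z = (if z \<in> ball 0 1 then z ^ j else 0)"

lemma taylor_coeff_monomial: "taylor_coeff (monomial j) i = (if i = j then 1 else 0)"
proof (rule taylor_coeff_eqI)
  fix z :: complex assume "z \<in> ball 0 1"
  then show "(\<lambda>i. (if i = j then 1 else 0) * z ^ i) sums monomial j z"
    using sums_single[of j "\<lambda>i. z ^ i"] by (simp add: monomial_def if_distrib[of "\<lambda>x. x * _"] cong: if_cong)
qed

lemma monomial_in_space: "monomial j \<in> bergman_space \<alpha>"
proof -
  have "monomial j holomorphic_on ball 0 1 \<longleftrightarrow> (\<lambda>z. z ^ j) holomorphic_on ball 0 1"
    by (rule holomorphic_cong) (auto simp: monomial_def)
  moreover have "summable (\<lambda>i. (cmod (taylor_coeff (monomial j) i))\<^sup>2 * bergman_weight \<alpha> i)"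
    by (rule summable_finite[of "{j}"]) (auto simp: taylor_coeff_monomial)
  ultimately show ?thesis
    by (auto simp: bergman_space_def monomial_def intro!: holomorphic_intros)
qed

lemma inner_monomial_left: "bergman_inner \<alpha> (monomial j) f = cnj (taylor_coeff f j) * of_real (bergman_weight \<alpha> j)"
  unfolding bergman_inner_def
  by (subst suminf_finite[of "{j}"]) (auto simp: taylor_coeff_monomial)

text \<open>Built from \<open>monomial\<close> instead of plain powers, so that it vanishes outside
  the disk and is an element of the space.\<close>

definition partial_taylor :: "(complex \<Rightarrow> complex) \<Rightarrow> nat \<Rightarrow> complex \<Rightarrow> complex" where
  "partial_taylor g N z = (\<Sum>j<N. taylor_coeff g j * monomial j z)"

lemma partial_taylor_Suc:
  "partial_taylor g (Suc N) = (\<lambda>z. 1 * partial_taylor g N z + taylor_coeff g N * monomial N z)"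
  by (simp add: partial_taylor_def fun_eq_iff)

text \<open>The zero function is written as a linear combination so that the base case of each
  induction uses the same linearity rule as the step; no separate fact about \<open>T\<close> at 0
  is required.\<close>

lemma partial_taylor_0: "partial_taylor g 0 = (\<lambda>z. 0 * monomial 0 z + 0 * monomial 0 z)"
  by (simp add: partial_taylor_def fun_eq_iff)

lemma partial_taylor_in_space: "partial_taylor g N \<in> bergman_space \<alpha>"
proof (induction N)
  case 0
  show ?case unfolding partial_taylor_0 by (intro lincomb_in_space monomial_in_space)
next
  case (Suc N)
  then show ?case unfolding partial_taylor_Suc by (intro lincomb_in_space monomial_in_space)
qed

lemma taylor_coeff_partial_taylor:
  "taylor_coeff (partial_taylor g N) j = (if j < N then taylor_coeff g j else 0)"
proof (induction N)
  case 0
  show ?case unfolding partial_taylor_0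
    by (subst taylor_coeff_lincomb) (auto intro: bergman_space_holomorphic monomial_in_space)
next
  case (Suc N)
  then show ?case unfolding partial_taylor_Suc
    by (subst taylor_coeff_lincomb)
      (auto simp: taylor_coeff_monomial less_Suc_eq
        intro: bergman_space_holomorphic monomial_in_space partial_taylor_in_space)
qed

text \<open>The remainder keeps exactly the coefficients of \<open>g\<close> from index
  \<open>N\<close> on, so its squared norm is a tail of a convergent series.\<close>

lemma partial_taylor_norm_tendsto:
  assumes g: "g \<in> bergman_space \<alpha>"
  shows "(\<lambda>N. bergman_norm \<alpha> (\<lambda>z. 1 * g z + (-1) * partial_taylor g N z)) \<longlonglongrightarrow> 0"
proof -
  let ?s = "\<lambda>h j. (cmod (taylor_coeff h j))\<^sup>2 * bergman_weight \<alpha> j"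
  let ?R = "\<lambda>N z. 1 * g z + (-1) * partial_taylor g N z"
  have eq: "bergman_norm \<alpha> (?R N) = sqrt (\<Sum>j. ?s g (j + N))" for N
  proof -
    have c: "taylor_coeff (?R N) j = (if j < N then 0 else taylor_coeff g j)" for j
      by (subst taylor_coeff_lincomb)
        (auto simp: taylor_coeff_partial_taylor intro: bergman_space_holomorphic[OF g]
          bergman_space_holomorphic[OF partial_taylor_in_space])
    have "summable (\<lambda>j. ?s g (j + N))"
      using bergman_space_summable[OF g] by (subst summable_iff_shift)
    then have "(\<lambda>j. ?s (?R N) (j + N)) sums (\<Sum>j. ?s g (j + N))"
      unfolding c by (simp add: summable_sums)
    then have "?s (?R N) sums (\<Sum>j. ?s g (j + N))"
      by (subst (asm) sums_zero_iff_shift) (auto simp only: c if_True norm_zero zero_power2 mult_zero_left)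
    then show ?thesis
      unfolding bergman_norm_def by (simp add: sums_iff)
  qed
  have "(\<lambda>N. \<Sum>j. ?s g (j + N)) \<longlonglongrightarrow> 0"
    by (rule suminf_exist_split2[OF bergman_space_summable[OF g]])
  from tendsto_real_sqrt[OF this] show ?thesis unfolding eq by simp
qed

text \<open>On Taylor polynomials this is linearity of \<open>T\<close>, with conjugates because the
  second slot of the inner product is antilinear. Cauchy-Schwarz and the operator bound
  \<open>M\<close> make the contribution of the remainder vanish in the limit.\<close>

lemma bounded_operator_inner_sums:
  assumes T: "bounded_operator \<alpha> T" and f: "f \<in> bergman_space \<alpha>" and g: "g \<in> bergman_space \<alpha>"
  shows "(\<lambda>j. cnj (taylor_coeff g j) * bergman_inner \<alpha> f (T (monomial j))) sums bergman_inner \<alpha> f (T g)"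
proof -
  have Tin: "h \<in> bergman_space \<alpha> \<Longrightarrow> T h \<in> bergman_space \<alpha>" for h
    using T by (auto simp: bounded_operator_def)
  have inner_T: "bergman_inner \<alpha> f (T (\<lambda>z. p * h z + q * k z))
      = cnj p * bergman_inner \<alpha> f (T h) + cnj q * bergman_inner \<alpha> f (T k)"
    if "h \<in> bergman_space \<alpha>" "k \<in> bergman_space \<alpha>" for p q h k
  proof -
    have "T (\<lambda>z. p * h z + q * k z) = (\<lambda>z. p * T h z + q * T k z)"
      using T that by (auto simp: bounded_operator_def)
    then show ?thesis using inner_lincomb_right[OF f Tin Tin] that by simp
  qed
  obtain M where M: "\<And>h. h \<in> bergman_space \<alpha> \<Longrightarrow> bergman_norm \<alpha> (T h) \<le> M * bergman_norm \<alpha> h"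
    using T unfolding bounded_operator_def by metis
  let ?S = "\<lambda>N. \<Sum>j<N. cnj (taylor_coeff g j) * bergman_inner \<alpha> f (T (monomial j))"
  let ?R = "\<lambda>N z. 1 * g z + (-1) * partial_taylor g N z"
  have S: "bergman_inner \<alpha> f (T (partial_taylor g N)) = ?S N" for N
  proof (induction N)
    case 0
    show ?case unfolding partial_taylor_0 by (subst inner_T) (auto intro: monomial_in_space)
  next
    case (Suc N)
    then show ?case unfolding partial_taylor_Suc
      by (subst inner_T) (auto intro: monomial_in_space partial_taylor_in_space)
  qed
  have R: "?R N \<in> bergman_space \<alpha>" for N
    by (rule lincomb_in_space[OF g partial_taylor_in_space])
  have diff: "bergman_inner \<alpha> f (T (?R N)) = bergman_inner \<alpha> f (T g) - ?S N" for N
    by (subst inner_T[OF g partial_taylor_in_space]) (simp add: S)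
  have nf: "bergman_norm \<alpha> f \<ge> 0"
    by (rule order.trans[OF L2_set_nonneg L2_set_le_bergman_norm[OF f, of 0]])
  have bound: "cmod (bergman_inner \<alpha> f (T g) - ?S N) \<le> bergman_norm \<alpha> f * (M * bergman_norm \<alpha> (?R N))" for N
    unfolding diff[symmetric]
    by (rule order.trans[OF inner_Cauchy_Schwarz[OF f Tin[OF R]] mult_left_mono[OF M[OF R] nf]])
  have "(\<lambda>N. bergman_norm \<alpha> f * (M * bergman_norm \<alpha> (?R N))) \<longlonglongrightarrow> bergman_norm \<alpha> f * (M * 0)"
    by (intro tendsto_intros partial_taylor_norm_tendsto g)
  then have "(\<lambda>N. bergman_norm \<alpha> f * (M * bergman_norm \<alpha> (?R N))) \<longlonglongrightarrow> 0" by simp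
  then have "(\<lambda>N. bergman_inner \<alpha> f (T g) - ?S N) \<longlonglongrightarrow> 0"
    by (rule Lim_null_comparison[rotated]) (use bound in auto)
  then have "(\<lambda>N. bergman_inner \<alpha> f (T g) - (bergman_inner \<alpha> f (T g) - ?S N)) \<longlonglongrightarrow> bergman_inner \<alpha> f (T g) - 0"
    by (intro tendsto_intros)
  then show ?thesis by (simp add: sums_def)
qed

section \<open>Closed form of the reproducing kernels\<close>

definition kernel_fun :: "complex \<Rightarrow> nat \<Rightarrow> complex \<Rightarrow> complex" where
  "kernel_fun w m z = (if z \<in> ball 0 1 then
     of_real (pochhammer (\<alpha> + 2) m) * z ^ m / (1 - cnj w * z) powr of_real (real m + \<alpha> + 2) else 0)"

text \<open>These values are forced by testing on monomials: the conjugated coefficient times the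
  weight is the \<open>m\<close>-th derivative of \<open>z ^ j\<close> at \<open>w\<close>. The case
  \<open>j < m\<close> is separate because \<open>j - m\<close> truncates to 0 there.\<close>

definition kernel_coeff :: "complex \<Rightarrow> nat \<Rightarrow> nat \<Rightarrow> complex" where
  "kernel_coeff w m j = (if j < m then 0 else
     of_real (pochhammer (\<alpha> + 2) j / fact (j - m)) * cnj w ^ (j - m))"

text \<open>This is the generalized binomial series with exponent \<open>- s\<close>. Passing from
  \<open>gchoose\<close> to \<open>pochhammer\<close> produces a sign that cancels the one from
  \<open>(- u) ^ i\<close>.\<close>

lemma binomial_series_neg:
  fixes u :: complex and s :: real
  assumes "cmod u < 1"
  shows "(\<lambda>i. of_real (pochhammer s i / fact i) * u ^ i) sums (inverse ((1 - u) powr of_real s))"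
proof -
  have "(\<lambda>i. ((- of_real s) gchoose i) * (- u) ^ i) sums (1 + (- u)) powr (- of_real s)"
    using assms by (intro gen_binomial_complex) simp
  moreover have "((- complex_of_real s) gchoose i) * (- u) ^ i = of_real (pochhammer s i / fact i) * u ^ i" for i
  proof -
    have "((- complex_of_real s) gchoose i) * (- u) ^ i
        = ((-1) ^ i * (-1) ^ i) * (pochhammer (of_real s) i / fact i * u ^ i)"
      unfolding gbinomial_pochhammer power_minus[of u] by simp
    also have "(-1) ^ i * (-1) ^ i = (1 :: complex)" by (simp flip: power_mult_distrib)
    finally show ?thesis by (simp flip: pochhammer_of_real)
  qed
  ultimately show ?thesis by (simp add: powr_minus)
qed

lemma kernel_coeff_sums:
  assumes w: "w \<in> ball 0 1" and z: "z \<in> ball 0 1"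
  shows "(\<lambda>j. kernel_coeff w m j * z ^ j) sums kernel_fun w m z"
proof -
  let ?s = "real m + \<alpha> + 2"
  have "(\<lambda>i. of_real (pochhammer (\<alpha> + 2) m) * z ^ m * (of_real (pochhammer ?s i / fact i) * (cnj w * z) ^ i))
      sums (of_real (pochhammer (\<alpha> + 2) m) * z ^ m * inverse ((1 - cnj w * z) powr of_real ?s))"
    by (intro sums_mult binomial_series_neg norm_cnj_mult_less_1 w z)
  \<comment> \<open>The product of the Pochhammer symbol of length \<open>m\<close> at \<alpha> + 2
    and the one of length \<open>i\<close> at \<alpha> + 2 + \<open>m\<close> is the one of length
    \<open>m + i\<close> at \<alpha> + 2.\<close>
  moreover have "of_real (pochhammer (\<alpha> + 2) m) * z ^ m * (of_real (pochhammer ?s i / fact i) * (cnj w * z) ^ i)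
      = kernel_coeff w m (i + m) * z ^ (i + m)" for i
    using pochhammer_product'[of "\<alpha> + 2" m i]
    by (simp add: kernel_coeff_def power_add power_mult_distrib add_ac)
  ultimately have "(\<lambda>i. kernel_coeff w m (i + m) * z ^ (i + m)) sums kernel_fun w m z"
    using z by (simp add: kernel_fun_def field_simps)
  then show ?thesis
    by (subst (asm) sums_zero_iff_shift) (auto simp: kernel_coeff_def)
qed

lemma taylor_coeff_kernel_fun: "w \<in> ball 0 1 \<Longrightarrow> taylor_coeff (kernel_fun w m) j = kernel_coeff w m j"
  by (intro taylor_coeff_eqI kernel_coeff_sums)

lemma kernel_fun_holomorphic: "w \<in> ball 0 1 \<Longrightarrow> kernel_fun w m holomorphic_on ball 0 1"
  by (rule power_series_holomorphic[of 0 1 "kernel_coeff w m"]) (simp add: kernel_coeff_sums)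

text \<open>The squared norm of a kernel is its own \<open>m\<close>-th derivative on the diagonal.
  Replacing \<open>w\<close> by its modulus \<open>r\<close> makes the Taylor series of that
  derivative at \<open>r\<close> coincide termwise with the norm series, and the former converges
  because \<open>r\<close> lies in the disk.\<close>

lemma kernel_fun_in_space:
  assumes w: "w \<in> ball 0 1"
  shows "kernel_fun w m \<in> bergman_space \<alpha>"
proof -
  define r where "r = complex_of_real (cmod w)"
  have r: "r \<in> ball 0 1" using w by (simp add: r_def)
  let ?h = "\<lambda>j. (cmod (kernel_coeff w m j))\<^sup>2 * bergman_weight \<alpha> j"
  have "summable (\<lambda>i. kernel_coeff r m (i + m) * (fact (i + m) / fact i) * r ^ i)"
    using sums_summable[OF higher_deriv_taylor_sums[OF kernel_fun_holomorphic[OF r] r, of m m]]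
    by (simp add: taylor_coeff_kernel_fun[OF r])
  moreover have "kernel_coeff r m (i + m) * (fact (i + m) / fact i) * r ^ i = of_real (?h (i + m))" for i
    using pochhammer_alpha_pos[of "i + m"]
    by (simp add: kernel_coeff_def r_def weight_eq norm_mult norm_power norm_divide power2_eq_square)
  ultimately have "summable (\<lambda>i. complex_of_real (?h (i + m)))" by simp
  then have "summable (\<lambda>i. ?h (i + m))" by (simp only: summable_of_real_iff)
  then have "summable ?h" by (subst (asm) summable_iff_shift)
  then show ?thesis
    using kernel_fun_holomorphic[OF w]
    by (auto simp: bergman_space_def taylor_coeff_kernel_fun[OF w] kernel_fun_def)
qed

text \<open>Weight and Pochhammer symbol cancel, so the inner product series is the termwise
  differentiated Taylor series of \<open>f\<close> at \<open>w\<close>.\<close>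

lemma inner_kernel_fun:
  assumes w: "w \<in> ball 0 1" and f: "f \<in> bergman_space \<alpha>"
  shows "bergman_inner \<alpha> f (kernel_fun w m) = (deriv ^^ m) f w"
proof -
  let ?h = "\<lambda>j. taylor_coeff f j * cnj (kernel_coeff w m j) * of_real (bergman_weight \<alpha> j)"
  have "taylor_coeff f (i + m) * (fact (i + m) / fact i) * w ^ i = ?h (i + m)" for i
    using pochhammer_alpha_pos[of "i + m"] by (simp add: kernel_coeff_def weight_eq)
  then have "(\<lambda>i. ?h (i + m)) sums (deriv ^^ m) f w"
    using higher_deriv_taylor_sums[OF bergman_space_holomorphic[OF f] w, of m] by simp
  then have "?h sums (deriv ^^ m) f w"
    by (subst (asm) sums_zero_iff_shift) (auto simp: kernel_coeff_def)
  then show ?thesis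
    using inner_sums[OF f kernel_fun_in_space[OF w], of m]
    unfolding taylor_coeff_kernel_fun[OF w] by (rule sums_unique2[symmetric])
qed

text \<open>Uniqueness for the description by \<open>THE\<close> comes from testing on monomials:
  their inner product with \<open>K\<close> is a conjugated coefficient of \<open>K\<close> times a
  nonzero weight.\<close>

lemma bergman_kernel_eq:
  assumes w: "w \<in> ball 0 1"
  shows "bergman_kernel \<alpha> w m = kernel_fun w m"
  unfolding bergman_kernel_def
proof (rule the_equality)
  fix K assume K: "K \<in> bergman_space \<alpha> \<and> (\<forall>f\<in>bergman_space \<alpha>. bergman_inner \<alpha> f K = (deriv ^^ m) f w)"
  show "K = kernel_fun w m"
  proof (rule bergman_space_eqI)
    fix j
    have "bergman_inner \<alpha> (monomial j) K = bergman_inner \<alpha> (monomial j) (kernel_fun w m)"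
      using K inner_kernel_fun[OF w monomial_in_space] monomial_in_space by simp
    then show "taylor_coeff K j = taylor_coeff (kernel_fun w m) j"
      by (simp add: inner_monomial_left)
  qed (use K kernel_fun_in_space[OF w] in auto)
qed (use kernel_fun_in_space inner_kernel_fun w in auto)

text \<open>The inner product of two kernels can be evaluated by the reproducing property of either
  one. This yields the derivative without differentiating a complex power.\<close>

lemma higher_deriv_kernel_fun_0:
  assumes w: "w \<in> ball 0 1" and z: "z \<in> ball 0 1"
  shows "(deriv ^^ m) (kernel_fun w 0) z = cnj (kernel_fun z m w)"
proof -
  have "(deriv ^^ m) (kernel_fun w 0) z = bergman_inner \<alpha> (kernel_fun w 0) (kernel_fun z m)"
    by (rule inner_kernel_fun[OF z kernel_fun_in_space[OF w], symmetric])
  also have "\<dots> = cnj (bergman_inner \<alpha> (kernel_fun z m) (kernel_fun w 0))"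
    by (rule inner_commute[OF kernel_fun_in_space[OF z] kernel_fun_in_space[OF w]])
  finally show ?thesis by (simp add: inner_kernel_fun[OF w kernel_fun_in_space[OF z]])
qed

text \<open>Forward: evaluations at \<open>z\<close> and \<open>w\<close> are inner products with
  kernels, so moving the operator across compares its value on the kernel of \<open>w\<close> at
  \<open>z\<close> with its value on the kernel of \<open>z\<close> at \<open>w\<close>. Backward:
  the identity says that the operator acts on kernels as its adjoint must, sending the kernel of
  \<open>w\<close> to \<open>cnj (\<psi> w)\<close> times the order-\<open>n\<close> kernel of
  \<open>\<phi> w\<close>.\<close>

lemma self_adjoint_comp_diff_op_iff:
  assumes T: "bounded_operator \<alpha> (comp_diff_op \<psi> \<phi> n)" and maps: "\<phi> ` ball 0 1 \<subseteq> ball 0 1"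
  shows "self_adjoint \<alpha> (comp_diff_op \<psi> \<phi> n) \<longleftrightarrow>
    (\<forall>z\<in>ball 0 1. \<forall>w\<in>ball 0 1.
       \<psi> z * cnj (kernel_fun (\<phi> z) n w) = cnj (\<psi> w) * kernel_fun (\<phi> w) n z)"
    (is "_ \<longleftrightarrow> ?sym")
proof -
  let ?T = "comp_diff_op \<psi> \<phi> n"
  have phi: "\<phi> z \<in> ball 0 1" if "z \<in> ball 0 1" for z
    using maps that by blast
  have Tin: "?T h \<in> bergman_space \<alpha>" if "h \<in> bergman_space \<alpha>" for h
    using T that by (auto simp: bounded_operator_def)
  have eval: "bergman_inner \<alpha> f (kernel_fun w 0) = f w" if "w \<in> ball 0 1" "f \<in> bergman_space \<alpha>" for f w
    using inner_kernel_fun[OF that, of 0] by simp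
  have TK: "?T (kernel_fun w 0) z = \<psi> z * cnj (kernel_fun (\<phi> z) n w)"
    if "z \<in> ball 0 1" "w \<in> ball 0 1" for z w
    using higher_deriv_kernel_fun_0[OF that(2) phi[OF that(1)], of n] that by (simp add: comp_diff_op_def)
  show ?thesis
  proof
    assume sa: "self_adjoint \<alpha> ?T"
    show ?sym
    proof (intro ballI)
      fix z w :: complex assume z: "z \<in> ball 0 1" and w: "w \<in> ball 0 1"
      note Kz = kernel_fun_in_space[OF z, of 0] and Kw = kernel_fun_in_space[OF w, of 0]
      have "?T (kernel_fun w 0) z = bergman_inner \<alpha> (?T (kernel_fun w 0)) (kernel_fun z 0)"
        using eval[OF z Tin[OF Kw]] by simp
      also have "\<dots> = bergman_inner \<alpha> (kernel_fun w 0) (?T (kernel_fun z 0))"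
        using sa Kz Kw by (auto simp: self_adjoint_def is_adjoint_def)
      also have "\<dots> = cnj (bergman_inner \<alpha> (?T (kernel_fun z 0)) (kernel_fun w 0))"
        by (rule inner_commute[OF Tin[OF Kz] Kw])
      also have "\<dots> = cnj (?T (kernel_fun z 0) w)"
        using eval[OF w Tin[OF Kz]] by simp
      finally show "\<psi> z * cnj (kernel_fun (\<phi> z) n w) = cnj (\<psi> w) * kernel_fun (\<phi> w) n z"
        by (simp add: TK[OF z w] TK[OF w z])
    qed
  next
    assume sym: ?sym
    \<comment> \<open>The vanishing second summand brings the scalar multiple into the form of
      \<open>inner_lincomb_right\<close>.\<close>
    have TK': "?T (kernel_fun w 0) = (\<lambda>z. cnj (\<psi> w) * kernel_fun (\<phi> w) n z + 0 * kernel_fun (\<phi> w) n z)"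
      if w: "w \<in> ball 0 1" for w
    proof
      fix z
      show "?T (kernel_fun w 0) z = cnj (\<psi> w) * kernel_fun (\<phi> w) n z + 0 * kernel_fun (\<phi> w) n z"
      proof (cases "z \<in> ball 0 1")
        case True
        then show ?thesis using sym w TK[OF True w] by simp
      next
        case False
        then show ?thesis by (simp add: comp_diff_op_def kernel_fun_def)
      qed
    qed
    have coeff: "taylor_coeff (?T f) j = bergman_inner \<alpha> f (?T (monomial j)) / of_real (bergman_weight \<alpha> j)"
      if f: "f \<in> bergman_space \<alpha>" for f j
    proof (rule taylor_coeff_eqI)
      fix w :: complex assume w: "w \<in> ball 0 1"
      have "bergman_inner \<alpha> f (?T (kernel_fun w 0)) = \<psi> w * (deriv ^^ n) f (\<phi> w)"
        unfolding TK'[OF w]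
        inner_lincomb_right[OF f kernel_fun_in_space[OF phi[OF w]] kernel_fun_in_space[OF phi[OF w]]]
          inner_kernel_fun[OF phi[OF w] f] by simp
      also have "\<dots> = ?T f w" using w by (simp add: comp_diff_op_def)
      finally have "(\<lambda>j. cnj (taylor_coeff (kernel_fun w 0) j) * bergman_inner \<alpha> f (?T (monomial j))) sums ?T f w"
        using bounded_operator_inner_sums[OF T f kernel_fun_in_space[OF w], of 0] by simp
      \<comment> \<open>For order 0 the conjugated kernel coefficient is \<open>w ^ j\<close>
        divided by the weight. The expansion is thus a power series in \<open>w\<close>, and its
        coefficients are the Taylor coefficients of \<open>?T f\<close>.\<close>
      moreover have "cnj (taylor_coeff (kernel_fun w 0) j) * bergman_inner \<alpha> f (?T (monomial j))
          = bergman_inner \<alpha> f (?T (monomial j)) / of_real (bergman_weight \<alpha> j) * w ^ j" for j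
        using pochhammer_alpha_pos[of j]
        by (simp add: taylor_coeff_kernel_fun[OF w] kernel_coeff_def weight_eq)
      ultimately show "(\<lambda>j. bergman_inner \<alpha> f (?T (monomial j)) / of_real (bergman_weight \<alpha> j) * w ^ j) sums ?T f w"
        by simp
    qed
    have "bergman_inner \<alpha> (?T f) g = bergman_inner \<alpha> f (?T g)"
      if f: "f \<in> bergman_space \<alpha>" and g: "g \<in> bergman_space \<alpha>" for f g
    proof -
      have "(\<lambda>j. cnj (taylor_coeff g j) * bergman_inner \<alpha> f (?T (monomial j))) sums bergman_inner \<alpha> (?T f) g"
        using inner_sums[OF Tin[OF f] g] by (simp add: coeff[OF f] mult_ac)
      then show ?thesis
        using bounded_operator_inner_sums[OF T f g] by (rule sums_unique2)
    qed
    then show "self_adjoint \<alpha> ?T"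
      using T Tin by (auto simp: self_adjoint_def is_adjoint_def)
  qed
qed

end

section \<open>The conjugations\<close>

lemma rotation_J_apply: "(rotation_op \<mu> \<circ> J_op) f z = cnj (f (cnj (\<mu> * z)))"
  by (simp add: rotation_op_def J_op_def)

lemma rotation_J_taylor:
  assumes f: "f holomorphic_on ball 0 1" and mu: "cmod \<mu> = 1" and z: "z \<in> ball 0 1"
  shows "(\<lambda>j. \<mu> ^ j * cnj (taylor_coeff f j) * z ^ j) sums (rotation_op \<mu> \<circ> J_op) f z"
proof -
  have "cnj (\<mu> * z) \<in> ball 0 1" using z mu by (simp add: norm_mult)
  from sums_cnj[THEN iffD2, OF taylor_coeff_sums[OF f this]] show ?thesis
    unfolding rotation_J_apply by (simp add: power_mult_distrib mult_ac)
qed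

lemma taylor_coeff_rotation_J:
  assumes "f holomorphic_on ball 0 1" "cmod \<mu> = 1"
  shows "taylor_coeff ((rotation_op \<mu> \<circ> J_op) f) j = \<mu> ^ j * cnj (taylor_coeff f j)"
  by (intro taylor_coeff_eqI rotation_J_taylor assms)

lemma rotation_J_holomorphic:
  assumes "f holomorphic_on ball 0 1" "cmod \<mu> = 1"
  shows "(rotation_op \<mu> \<circ> J_op) f holomorphic_on ball 0 1"
  using rotation_J_taylor[OF assms]
  by (intro power_series_holomorphic[of 0 1 "\<lambda>j. \<mu> ^ j * cnj (taylor_coeff f j)"]) simp

text \<open>A chain rule through two complex conjugations. Comparing Taylor coefficients avoids
  differentiating the conjugation, which is not holomorphic.\<close>

lemma higher_deriv_rotation_J:
  assumes f: "f holomorphic_on ball 0 1" and mu: "cmod \<mu> = 1" and z: "z \<in> ball 0 1"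
  shows "(deriv ^^ m) ((rotation_op \<mu> \<circ> J_op) f) z = \<mu> ^ m * cnj ((deriv ^^ m) f (cnj (\<mu> * z)))"
proof -
  have mz: "cnj (\<mu> * z) \<in> ball 0 1" using z mu by (simp add: norm_mult)
  have "(\<lambda>i. \<mu> ^ m * cnj (taylor_coeff f (i + m) * (fact (i + m) / fact i) * cnj (\<mu> * z) ^ i))
      sums (\<mu> ^ m * cnj ((deriv ^^ m) f (cnj (\<mu> * z))))"
    by (intro sums_mult sums_cnj[THEN iffD2] higher_deriv_taylor_sums f mz)
  moreover have "\<mu> ^ m * cnj (taylor_coeff f (i + m) * (fact (i + m) / fact i) * cnj (\<mu> * z) ^ i)
      = taylor_coeff ((rotation_op \<mu> \<circ> J_op) f) (i + m) * (fact (i + m) / fact i) * z ^ i" for i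
    unfolding taylor_coeff_rotation_J[OF f mu] by (simp add: power_add power_mult_distrib mult_ac)
  ultimately have "(\<lambda>i. taylor_coeff ((rotation_op \<mu> \<circ> J_op) f) (i + m) * (fact (i + m) / fact i) * z ^ i)
      sums (\<mu> ^ m * cnj ((deriv ^^ m) f (cnj (\<mu> * z))))" by (simp only:)
  then show ?thesis
    using higher_deriv_taylor_sums[OF rotation_J_holomorphic[OF f mu] z, of m] sums_unique2 by blast
qed

text \<open>The map conjugates each Taylor coefficient and multiplies it by a unimodular number, so
  all moduli and hence the norm are preserved.\<close>

lemma conjugation_rotation_J:
  assumes mu: "cmod \<mu> = 1"
  shows "conjugation \<alpha> (rotation_op \<mu> \<circ> J_op)"
proof -
  have coeff: "cmod (taylor_coeff ((rotation_op \<mu> \<circ> J_op) f) j) = cmod (taylor_coeff f j)"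
    if "f \<in> bergman_space \<alpha>" for f j
    using taylor_coeff_rotation_J[OF bergman_space_holomorphic[OF that] mu] mu
    by (simp add: norm_mult norm_power)
  have "(rotation_op \<mu> \<circ> J_op) f \<in> bergman_space \<alpha>" if f: "f \<in> bergman_space \<alpha>" for f
  proof -
    have "(rotation_op \<mu> \<circ> J_op) f z = 0" if "z \<notin> ball 0 1" for z
      using bergman_space_outside[OF f, of "cnj (\<mu> * z)"] that mu
      unfolding rotation_J_apply by (simp add: norm_mult)
    then show ?thesis
      using f coeff[OF f] rotation_J_holomorphic[OF bergman_space_holomorphic[OF f] mu]
      by (simp add: bergman_space_def)
  qed
  moreover have "bergman_norm \<alpha> ((rotation_op \<mu> \<circ> J_op) f) = bergman_norm \<alpha> f"
    if "f \<in> bergman_space \<alpha>" for f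
    unfolding bergman_norm_def coeff[OF that] ..
  moreover have "(rotation_op \<mu> \<circ> J_op) ((rotation_op \<mu> \<circ> J_op) f) = f" for f
  proof
    fix z
    have "cnj \<mu> * \<mu> = 1" using mu complex_norm_square[of \<mu>] by (simp add: mult.commute)
    then have "cnj \<mu> * (\<mu> * z) = z" by (metis mult.assoc mult_1)
    then show "(rotation_op \<mu> \<circ> J_op) ((rotation_op \<mu> \<circ> J_op) f) z = f z"
      unfolding rotation_J_apply complex_cnj_mult complex_cnj_cnj by (simp only:)
  qed
  ultimately show ?thesis
    unfolding conjugation_def by (auto simp: rotation_op_def J_op_def)
qed

text \<open>A self-adjoint operator is its own adjoint, so only \<open>C T C = T\<close> remains.
  The conditions on the two symbols say that each is invariant under the conjugated rotation, with
  the extra factor \<open>\<mu> ^ n\<close> coming from the \<open>n\<close> derivatives.\<close>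

lemma C_symmetric_comp_diff_op:
  assumes sa: "self_adjoint \<alpha> (comp_diff_op \<psi> \<phi> n)" and maps: "\<phi> ` ball 0 1 \<subseteq> ball 0 1"
    and mu: "cmod \<mu> = 1"
    and psi: "\<And>z. z \<in> ball 0 1 \<Longrightarrow> cnj (\<mu> ^ n * \<psi> (cnj (\<mu> * z))) = \<psi> z"
    and phi: "\<And>z. z \<in> ball 0 1 \<Longrightarrow> cnj (\<mu> * \<phi> (cnj (\<mu> * z))) = \<phi> z"
  shows "C_symmetric \<alpha> (rotation_op \<mu> \<circ> J_op) (comp_diff_op \<psi> \<phi> n)"
proof -
  let ?T = "comp_diff_op \<psi> \<phi> n" and ?C = "rotation_op \<mu> \<circ> J_op"
  have "?C (?T (?C f)) = ?T f" if f: "f \<in> bergman_space \<alpha>" for f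
  proof
    fix z
    show "?C (?T (?C f)) z = ?T f z"
    proof (cases "z \<in> ball 0 1")
      case True
      let ?z = "cnj (\<mu> * z)"
      have z: "?z \<in> ball 0 1" using True mu by (simp add: norm_mult)
      then have "\<phi> ?z \<in> ball 0 1" using maps by blast
      note d = higher_deriv_rotation_J[OF bergman_space_holomorphic[OF f] mu this, of n]
      have "?T (?C f) ?z = \<psi> ?z * (\<mu> ^ n * cnj ((deriv ^^ n) f (\<phi> z)))"
        using z unfolding comp_diff_op_def d phi[OF True] by simp
      then have "?C (?T (?C f)) z = cnj (\<mu> ^ n * \<psi> ?z) * (deriv ^^ n) f (\<phi> z)"
        unfolding rotation_J_apply[of \<mu> "?T (?C f)"] by (simp add: mult_ac)
      then show ?thesis
        using True unfolding psi[OF True] by (simp add: comp_diff_op_def)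
    next
      case False
      then show ?thesis
        unfolding rotation_J_apply[of \<mu> "comp_diff_op _ _ _ _"] using mu
        by (simp add: comp_diff_op_def norm_mult)
    qed
  qed
  then show ?thesis
    using sa conjugation_rotation_J[OF mu] unfolding C_symmetric_def self_adjoint_def by blast
qed

section \<open>The functional equation for the symbols\<close>

text \<open>Keeps every base of a complex power in the right half-plane, where the principal branch
  is differentiable, commutes with conjugation and is multiplicative.\<close>

lemma Re_one_minus_cnj_mult_pos:
  assumes "w \<in> ball 0 1" "z \<in> ball 0 1"
  shows "Re (1 - cnj w * z) > 0"
proof -
  show ?thesis using norm_cnj_mult_less_1[OF assms] complex_Re_le_cmod[of "cnj w * z"] by simp
qed

text \<open>Both arguments lie strictly between -pi/2 and pi/2, so their sum stays within the
  principal range and the logarithms add.\<close>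

lemma powr_mult_Re_pos:
  assumes "Re x > 0" "Re y > 0"
  shows "(x * y) powr s = x powr s * y powr (s :: complex)"
proof -
  have nz: "x \<noteq> 0" "y \<noteq> 0" using assms by auto
  have "\<bar>Im (Ln x)\<bar> < pi / 2" "\<bar>Im (Ln y)\<bar> < pi / 2"
    unfolding Re_Ln_pos_lt[OF nz(1)] Re_Ln_pos_lt[OF nz(2)] by fact+
  then have "Ln (x * y) = Ln x + Ln y"
    using nz by (intro Ln_times_simple) auto
  then show ?thesis using nz by (simp add: powr_def ring_distribs exp_add)
qed

lemma powr_nonzero_Re_pos: "Re x > 0 \<Longrightarrow> x powr (s :: complex) \<noteq> 0"
  by (auto simp: powr_def)

lemma cnj_powr_of_real:
  assumes "Re x > 0"
  shows "cnj (x powr of_real s) = cnj x powr of_real s"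
  using assms by (subst cnj_powr) auto

lemma symmetric_symbols:
  fixes \<psi> \<phi> :: "complex \<Rightarrow> complex" and s :: real
  assumes n: "n > 0" and s: "s \<noteq> 0"
    and phi: "\<phi> holomorphic_on ball 0 1" and maps: "\<phi> ` ball 0 1 \<subseteq> ball 0 1"
    and nonzero: "\<exists>z\<in>ball 0 1. \<psi> z \<noteq> 0"
    and sym: "\<And>z w. z \<in> ball 0 1 \<Longrightarrow> w \<in> ball 0 1 \<Longrightarrow>
      \<psi> w * cnj z ^ n * (1 - cnj (\<phi> z) * w) powr of_real s
        = cnj (\<psi> z) * w ^ n * (1 - cnj z * \<phi> w) powr of_real s"
  obtains L :: complex where "L \<in> \<real>" "L \<noteq> 0" "deriv \<phi> 0 \<in> \<real>"
    "\<And>z. z \<in> ball 0 1 \<Longrightarrow> \<psi> z = L * z ^ n / (1 - cnj (\<phi> 0) * z) powr of_real s"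
    "\<And>z. z \<in> ball 0 1 \<Longrightarrow> \<phi> z = \<phi> 0 + deriv \<phi> 0 * z / (1 - cnj (\<phi> 0) * z)"
proof -
  define c where "c = \<phi> 0"
  let ?s = "complex_of_real s"
  have phi_in: "\<phi> z \<in> ball 0 1" if "z \<in> ball 0 1" for z
    using maps that by blast
  have c: "c \<in> ball 0 1" unfolding c_def by (rule phi_in) simp
  have pos: "Re (1 - cnj u * v) > 0" if "u \<in> ball 0 1" "v \<in> ball 0 1" for u v
    using Re_one_minus_cnj_mult_pos[OF that] .
  have nonpos: "x \<notin> \<real>\<^sub>\<le>\<^sub>0" if "Re x > 0" for x
    using that by (auto simp: complex_nonpos_Reals_iff)
  note nz = powr_nonzero_Re_pos[of _ ?s]
  have phi_deriv: "(\<phi> has_field_derivative deriv \<phi> 0) (at 0)"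
    using phi by (intro holomorphic_derivI[of _ "ball 0 1"]) auto
  then have phi_lim: "(\<phi> \<longlongrightarrow> c) (at 0)"
    unfolding c_def using DERIV_isCont isCont_def by blast
  have near: "\<forall>\<^sub>F w in at 0. w \<in> ball 0 1 - {0 :: complex}"
    by (rule eventually_at_in_open) auto
  \<comment> \<open>Solving the functional equation for \<open>\<psi> w / w ^ n\<close> with
    \<open>z\<close> fixed and letting \<open>w\<close> tend to 0 gives \<open>G z\<close>. The
    quotient does not involve \<open>z\<close>, so \<open>G\<close> is constant away from 0.\<close>
  define G where "G z = cnj (\<psi> z) / cnj z ^ n * (1 - cnj z * c) powr ?s" for z
  have lim: "((\<lambda>w. \<psi> w / w ^ n) \<longlongrightarrow> G z) (at 0)" if z: "z \<in> ball 0 1" "z \<noteq> 0" for z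
  proof -
    let ?g = "\<lambda>w. cnj (\<psi> z) / cnj z ^ n * (1 - cnj z * \<phi> w) powr ?s / (1 - cnj (\<phi> z) * w) powr ?s"
    have "(?g \<longlongrightarrow> cnj (\<psi> z) / cnj z ^ n * (1 - cnj z * c) powr ?s / (1 - cnj (\<phi> z) * 0) powr ?s) (at 0)"
      using nonpos[OF pos[OF z(1) c]]
      by (intro tendsto_divide tendsto_mult tendsto_const tendsto_powr_complex tendsto_diff phi_lim
          tendsto_ident_at) auto
    then have "(?g \<longlongrightarrow> G z) (at 0)" by (simp add: G_def)
    moreover have "\<forall>\<^sub>F w in at 0. ?g w = \<psi> w / w ^ n"
      using near
    proof eventually_elim
      case (elim w)
      then show ?case
        using sym[OF z(1), of w] z nz[OF pos[OF phi_in[OF z(1)], of w]] by (simp add: field_simps)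
    qed
    ultimately show ?thesis by (rule Lim_transform_eventually)
  qed
  \<comment> \<open>The point 1/2 is an arbitrary nonzero sample of the constant function
    \<open>G\<close>.\<close>
  define L where "L = cnj (G (1/2))"
  have half: "(1/2 :: complex) \<in> ball 0 1" "(1/2 :: complex) \<noteq> 0" by auto
  have psi: "\<psi> z = L * z ^ n / (1 - cnj c * z) powr ?s" if z: "z \<in> ball 0 1" for z
  proof (cases "z = 0")
    case True
    then show ?thesis
      using sym[OF half(1), of 0] n by (simp add: power_0_left)
  next
    case False
    have "G z = G (1/2)"
      by (rule tendsto_unique[OF _ lim[OF z False] lim[OF half]]) simp
    then have "cnj (G z) = L" by (simp add: L_def)
    moreover have "cnj (G z) = \<psi> z / z ^ n * (1 - cnj c * z) powr ?s"
      using cnj_powr_of_real[OF pos[OF z c], of s] by (simp add: G_def mult.commute)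
    ultimately show ?thesis
      using False nz[OF pos[OF c z]] by (simp add: field_simps)
  qed
  \<comment> \<open>The formula for \<open>\<psi>\<close> gives the limit \<open>L\<close> for
    \<open>\<psi> w / w ^ n\<close>, whereas \<open>lim\<close> gives \<open>G (1/2)\<close>, the
    conjugate of \<open>L\<close>.\<close>
  have L_real: "L \<in> \<real>"
  proof -
    have "((\<lambda>w. L / (1 - cnj c * w) powr ?s) \<longlongrightarrow> L / (1 - cnj c * 0) powr ?s) (at 0)"
      by (intro tendsto_divide tendsto_const tendsto_powr_complex tendsto_diff tendsto_mult
          tendsto_ident_at) auto
    moreover have "\<forall>\<^sub>F w in at 0. L / (1 - cnj c * w) powr ?s = \<psi> w / w ^ n"
      using near by eventually_elim (simp add: psi)
    ultimately have "((\<lambda>w. \<psi> w / w ^ n) \<longlongrightarrow> L / (1 - cnj c * 0) powr ?s) (at 0)"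
      by (rule Lim_transform_eventually)
    then have "L = G (1/2)"
      using tendsto_unique[OF _ _ lim[OF half]] by force
    then show ?thesis by (simp add: L_def Reals_cnj_iff)
  qed
  have L_nz: "L \<noteq> 0" using nonzero psi by auto
  have phi_eq: "\<phi> z = c + cnj (deriv \<phi> 0) * z / (1 - cnj c * z)" if z: "z \<in> ball 0 1" for z
  proof (cases "z = 0")
    case True
    then show ?thesis by (simp add: c_def)
  next
    case False
    let ?A = "1 - cnj z * c"
    let ?l = "\<lambda>w. ?A powr ?s * (1 - cnj (\<phi> z) * w) powr ?s"
    let ?r = "\<lambda>w. (1 - cnj c * w) powr ?s * (1 - cnj z * \<phi> w) powr ?s"
    \<comment> \<open>For \<open>w\<close> nonzero, insert the formula for \<open>\<psi>\<close> on
      both sides and cancel \<open>L\<close>, \<open>cnj z ^ n\<close> and \<open>w ^ n\<close>. At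
      0 both sides equal \<open>?A powr ?s\<close>, so the identity holds on a full neighbourhood of
      0 and may be differentiated there.\<close>
    have eq: "?l w = ?r w" if w: "w \<in> ball 0 1" for w
    proof (cases "w = 0")
      case True
      then show ?thesis by (simp add: c_def)
    next
      case w0: False
      have "cnj (\<psi> z) = L * cnj z ^ n / ?A powr ?s"
        using psi[OF z] L_real cnj_powr_of_real[OF pos[OF c z], of s]
        by (simp add: Reals_cnj_iff mult.commute)
      then show ?thesis
        using sym[OF z w] psi[OF w] False w0 L_nz nz[OF pos[OF z c]] nz[OF pos[OF c w]]
        by (simp add: field_simps)
    qed
    have A: "?A \<noteq> 0" using pos[OF z c] by force
    have "((\<lambda>w. (1 - cnj (\<phi> z) * w) powr ?s) has_field_derivative
        ?s * (1 - cnj (\<phi> z) * 0) powr (?s - 1) * (- cnj (\<phi> z))) (at 0)"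
      by (rule DERIV_chain2[OF has_field_derivative_powr]) (auto intro!: derivative_eq_intros)
    from DERIV_cmult[OF this, of "?A powr ?s"]
    have l: "(?l has_field_derivative ?A powr ?s * (?s * (- cnj (\<phi> z)))) (at 0)" by simp
    have r1: "((\<lambda>w. (1 - cnj c * w) powr ?s) has_field_derivative
        ?s * (1 - cnj c * 0) powr (?s - 1) * (- cnj c)) (at 0)"
      by (rule DERIV_chain2[OF has_field_derivative_powr]) (auto intro!: derivative_eq_intros)
    have "?A \<notin> \<real>\<^sub>\<le>\<^sub>0" by (rule nonpos[OF pos[OF z c]])
    then have r2: "((\<lambda>w. (1 - cnj z * \<phi> w) powr ?s) has_field_derivative
        ?s * (1 - cnj z * \<phi> 0) powr (?s - 1) * (- cnj z * deriv \<phi> 0)) (at 0)"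
      by (intro DERIV_chain2[OF has_field_derivative_powr])
        (auto intro!: derivative_eq_intros phi_deriv simp: c_def)
    have r: "(?r has_field_derivative ?s * (- cnj c) * ?A powr ?s
        + ?s * ?A powr (?s - 1) * (- cnj z * deriv \<phi> 0)) (at 0)"
      using DERIV_mult[OF r1 r2] by (simp add: c_def mult_ac)
    have "(?r has_field_derivative ?A powr ?s * (?s * (- cnj (\<phi> z)))) (at 0)"
      by (rule has_field_derivative_transform_within_open[OF l, of "ball 0 1"]) (use eq in auto)
    \<comment> \<open>Two expressions for the same derivative at 0; the common factor
      \<open>?s * ?A powr ?s\<close> is nonzero and cancels, leaving
      \<open>\<phi> z\<close>.\<close>
    from DERIV_unique[OF this r]
    have "?s * (?A powr ?s * cnj (\<phi> z)) = ?s * (?A powr ?s * (cnj c + deriv \<phi> 0 * cnj z / ?A))"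
      using A by (simp add: powr_diff algebra_simps)
    then have "cnj (\<phi> z) = cnj c + deriv \<phi> 0 * cnj z / ?A"
      using s nz[OF pos[OF z c]] by simp
    then have "cnj (cnj (\<phi> z)) = cnj (cnj c + deriv \<phi> 0 * cnj z / ?A)" by simp
    then show ?thesis by (simp add: mult.commute)
  qed
  \<comment> \<open>Differentiating the formula just found for \<open>\<phi>\<close> at 0 shows that
    its derivative there equals its own conjugate.\<close>
  have "((\<lambda>z. c + cnj (deriv \<phi> 0) * z / (1 - cnj c * z)) has_field_derivative cnj (deriv \<phi> 0)) (at 0)"
    by (auto intro!: derivative_eq_intros)
  then have "(\<phi> has_field_derivative cnj (deriv \<phi> 0)) (at 0)"
    by (rule has_field_derivative_transform_within_open[of _ _ _ "ball 0 1"]) (use phi_eq in auto)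
  then have b: "cnj (deriv \<phi> 0) = deriv \<phi> 0"
    using phi_deriv DERIV_unique by blast
  show thesis
  proof (rule that[OF L_real L_nz])
    show "deriv \<phi> 0 \<in> \<real>" using b by (simp add: Reals_cnj_iff)
  qed (unfold c_def[symmetric], fact psi, use phi_eq b in simp)
qed

text \<open>After clearing denominators, \<open>(1 - cnj c * z) * (1 - cnj w * \<phi> z)\<close> and
  \<open>(1 - cnj w * c) * (1 - cnj (\<phi> w) * z)\<close> are the same polynomial in
  \<open>z\<close> and \<open>cnj w\<close>. All four factors have positive real part, so the
  identity passes to powers.\<close>

lemma symbols_symmetric:
  fixes \<psi> \<phi> :: "complex \<Rightarrow> complex" and s :: real
  assumes maps: "\<phi> ` ball 0 1 \<subseteq> ball 0 1" and c: "c \<in> ball 0 1" and L: "L \<in> \<real>" and b: "b \<in> \<real>"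
    and psi: "\<And>z. z \<in> ball 0 1 \<Longrightarrow> \<psi> z = L * z ^ n / (1 - cnj c * z) powr of_real s"
    and phi: "\<And>z. z \<in> ball 0 1 \<Longrightarrow> \<phi> z = c + b * z / (1 - cnj c * z)"
    and z: "z \<in> ball 0 1" and w: "w \<in> ball 0 1"
  shows "\<psi> z * cnj w ^ n / (1 - cnj w * \<phi> z) powr of_real s
    = cnj (\<psi> w) * z ^ n / (1 - cnj (\<phi> w) * z) powr of_real s"
proof -
  let ?s = "complex_of_real s"
  have phi_in: "\<phi> z \<in> ball 0 1" "\<phi> w \<in> ball 0 1" using maps z w by blast+
  note pos = Re_one_minus_cnj_mult_pos[OF c z] Re_one_minus_cnj_mult_pos[OF w phi_in(1)]
    Re_one_minus_cnj_mult_pos[OF w c] Re_one_minus_cnj_mult_pos[OF phi_in(2) z]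
  have nz: "1 - cnj c * z \<noteq> 0" "1 - cnj w * c \<noteq> 0" using pos by force+
  have "(1 - cnj c * z) * \<phi> z = c * (1 - cnj c * z) + b * z"
    using nz by (simp add: phi[OF z] field_simps)
  moreover have "(1 - cnj w * c) * cnj (\<phi> w) = cnj c * (1 - cnj w * c) + b * cnj w"
  proof -
    have "cnj (\<phi> w) = cnj c + b * cnj w / (1 - cnj w * c)"
      using b by (simp add: phi[OF w] Reals_cnj_iff mult.commute)
    then show ?thesis using nz by (simp add: field_simps)
  qed
  ultimately have "(1 - cnj c * z) * (1 - cnj w * \<phi> z) = (1 - cnj w * c) * (1 - cnj (\<phi> w) * z)"
    by algebra
  then have "(1 - cnj c * z) powr ?s * (1 - cnj w * \<phi> z) powr ?s
      = (1 - cnj w * c) powr ?s * (1 - cnj (\<phi> w) * z) powr ?s"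
    using pos by (metis powr_mult_Re_pos)
  moreover have "cnj (\<psi> w) = L * cnj w ^ n / (1 - cnj w * c) powr ?s"
    using L cnj_powr_of_real[OF Re_one_minus_cnj_mult_pos[OF c w], of s]
    by (simp add: psi[OF w] Reals_cnj_iff mult.commute)
  ultimately show ?thesis by (simp add: psi[OF z] mult_ac)
qed

section \<open>Characterization of self-adjointness and the resulting complex symmetries\<close>

theorem proposition3p1:
  fixes \<alpha> :: real and n :: nat and \<psi> \<phi> :: "complex \<Rightarrow> complex"
    and a b c :: complex and t \<theta> :: real
  assumes "\<alpha> > -1" and "n > 0"
    and "\<psi> holomorphic_on ball 0 1" and "\<exists>z\<in>ball 0 1. \<psi> z \<noteq> 0"
    and "\<phi> holomorphic_on ball 0 1" and "\<phi> ` ball 0 1 \<subseteq> ball 0 1"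
    and "\<not> \<phi> constant_on ball 0 1"
    and "bounded_operator \<alpha> (comp_diff_op \<psi> \<phi> n)"
    and "a = (deriv ^^ n) \<psi> 0" and "b = deriv \<phi> 0" and "c = \<phi> 0"
    and "t = (\<Prod>k=1..n. \<alpha> + real k + 1)" and "\<theta> = Arg2pi c"
  shows "(self_adjoint \<alpha> (comp_diff_op \<psi> \<phi> n) \<longleftrightarrow>
            (\<forall>z\<in>ball 0 1.
               \<psi> z = a * z ^ n / (fact n * (1 - cnj c * z) powr of_real (real n + \<alpha> + 2)) \<and>
               \<psi> z = a / (of_real t * fact n) * bergman_kernel \<alpha> c n z \<and>
               \<phi> z = c + b * z / (1 - cnj c * z)) \<and>
            a \<in> \<real> \<and> a \<noteq> 0 \<and> b \<in> \<real> \<and> b \<noteq> 0 \<and> c \<in> ball 0 1) \<and>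
         (self_adjoint \<alpha> (comp_diff_op \<psi> \<phi> n) \<longrightarrow>
            (c = 0 \<longrightarrow> C_symmetric \<alpha> J_op (comp_diff_op \<psi> \<phi> n)) \<and>
            (c \<noteq> 0 \<longrightarrow> C_symmetric \<alpha> (rotation_op (exp (- 2 * \<i> * of_real \<theta>)) \<circ> J_op)
               (comp_diff_op \<psi> \<phi> n)))"
proof -
  interpret weighted_bergman \<alpha> by unfold_locales fact
  let ?T = "comp_diff_op \<psi> \<phi> n" and ?s = "real n + \<alpha> + 2"
  let ?p = "complex_of_real (pochhammer (\<alpha> + 2) n)"
  note maps = assms(6)
  have phi_in: "\<phi> z \<in> ball 0 1" if "z \<in> ball 0 1" for z
    using maps that by blast
  have c: "c \<in> ball 0 1" unfolding assms(11) by (rule phi_in) simp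
  have t: "of_real t = ?p"
    unfolding assms(12) of_real_eq_iff by (induction n) (simp_all add: pochhammer_Suc algebra_simps)
  have p: "?p \<noteq> 0" using pochhammer_alpha_pos[of n] by simp
  have K: "a / (of_real t * fact n) * bergman_kernel \<alpha> c n z
      = a * z ^ n / (fact n * (1 - cnj c * z) powr of_real ?s)" if "z \<in> ball 0 1" for z
    using that p by (simp add: bergman_kernel_eq[OF c] kernel_fun_def t)
  have kernel: "cnj (kernel_fun (\<phi> z) n w) = ?p * (cnj w ^ n / (1 - cnj w * \<phi> z) powr of_real ?s)"
    "kernel_fun (\<phi> w) n z = ?p * (z ^ n / (1 - cnj (\<phi> w) * z) powr of_real ?s)"
    if "z \<in> ball 0 1" "w \<in> ball 0 1" for z w
    using that cnj_powr_of_real[OF Re_one_minus_cnj_mult_pos[OF phi_in[OF that(1)] that(2)], of ?s]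
    by (simp_all add: kernel_fun_def mult.commute)
  have sa_iff: "self_adjoint \<alpha> ?T \<longleftrightarrow> (\<forall>z\<in>ball 0 1. \<forall>w\<in>ball 0 1.
      \<psi> z * cnj w ^ n / (1 - cnj w * \<phi> z) powr of_real ?s
        = cnj (\<psi> w) * z ^ n / (1 - cnj (\<phi> w) * z) powr of_real ?s)"
    unfolding self_adjoint_comp_diff_op_iff[OF assms(8) maps]
  proof (intro ball_cong refl)
    fix z w :: complex assume zw: "z \<in> ball 0 1" "w \<in> ball 0 1"
    let ?u = "\<psi> z * cnj w ^ n / (1 - cnj w * \<phi> z) powr complex_of_real ?s"
      and ?v = "cnj (\<psi> w) * z ^ n / (1 - cnj (\<phi> w) * z) powr complex_of_real ?s"
    have "\<psi> z * cnj (kernel_fun (\<phi> z) n w) = ?p * ?u" "cnj (\<psi> w) * kernel_fun (\<phi> w) n z = ?p * ?v"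
      unfolding kernel[OF zw] by simp_all
    then show "\<psi> z * cnj (kernel_fun (\<phi> z) n w) = cnj (\<psi> w) * kernel_fun (\<phi> w) n z \<longleftrightarrow> ?u = ?v"
      using p by (simp only: mult_cancel_left) blast
  qed
  have forward: "(\<forall>z\<in>ball 0 1. \<psi> z = a * z ^ n / (fact n * (1 - cnj c * z) powr of_real ?s) \<and>
        \<phi> z = c + b * z / (1 - cnj c * z)) \<and> a \<in> \<real> \<and> a \<noteq> 0 \<and> b \<in> \<real> \<and> b \<noteq> 0"
    if sa: "self_adjoint \<alpha> ?T"
  proof -
    have nz: "(1 - cnj u * v) powr complex_of_real ?s \<noteq> 0" if "u \<in> ball 0 1" "v \<in> ball 0 1" for u v
      by (rule powr_nonzero_Re_pos[OF Re_one_minus_cnj_mult_pos[OF that]])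
    have "\<psi> w * cnj z ^ n * (1 - cnj (\<phi> z) * w) powr of_real ?s
        = cnj (\<psi> z) * w ^ n * (1 - cnj z * \<phi> w) powr of_real ?s"
      if z: "z \<in> ball 0 1" and w: "w \<in> ball 0 1" for z w
    proof -
      have "\<psi> w * cnj z ^ n / (1 - cnj z * \<phi> w) powr of_real ?s
          = cnj (\<psi> z) * w ^ n / (1 - cnj (\<phi> z) * w) powr of_real ?s"
        using sa z w unfolding sa_iff by blast
      then show ?thesis
        using nz[OF z phi_in[OF w]] nz[OF phi_in[OF z] w] by (simp add: frac_eq_eq)
    qed
    moreover have "?s \<noteq> 0" using assms(1) by linarith
    ultimately obtain L where L: "L \<in> \<real>" "L \<noteq> 0" and b: "deriv \<phi> 0 \<in> \<real>"
      and psi: "\<And>z. z \<in> ball 0 1 \<Longrightarrow> \<psi> z = L * z ^ n / (1 - cnj (\<phi> 0) * z) powr of_real ?s"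
      and phi: "\<And>z. z \<in> ball 0 1 \<Longrightarrow> \<phi> z = \<phi> 0 + deriv \<phi> 0 * z / (1 - cnj (\<phi> 0) * z)"
      using symmetric_symbols[OF assms(2) _ assms(5,6,4)] by metis
    note b = b[folded assms(10)] and psi = psi[folded assms(11)] and phi = phi[folded assms(10,11)]
    \<comment> \<open>Writing \<open>\<psi>\<close> as a multiple of a kernel lets \<open>a\<close>
      be read off: the first nonzero kernel coefficient \<open>kernel_coeff c n n\<close> is
      \<open>?p\<close>, whence \<open>a = fact n * L\<close>.\<close>
    have "taylor_coeff \<psi> n = L / ?p * kernel_coeff c n n"
    proof (rule taylor_coeff_eqI[where c = "\<lambda>j. L / ?p * kernel_coeff c n j"])
      fix z :: complex assume z: "z \<in> ball 0 1"
      have "\<psi> z = L / ?p * kernel_fun c n z"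
        using p z by (simp add: psi[OF z] kernel_fun_def)
      then show "(\<lambda>j. L / ?p * kernel_coeff c n j * z ^ j) sums \<psi> z"
        using sums_mult[OF kernel_coeff_sums[OF c z, of n], of "L / ?p"] by (simp add: mult.assoc)
    qed
    then have a: "a = fact n * L"
      using p by (simp add: taylor_coeff_def kernel_coeff_def assms(9) field_simps)
    have "b \<noteq> 0"
    proof
      assume "b = 0"
      then have "\<forall>z\<in>ball 0 1. \<phi> z = c" using phi by simp
      then have "\<phi> constant_on ball 0 1" unfolding constant_on_def by blast
      then show False using assms(7) by blast
    qed
    moreover have "a \<in> \<real>" unfolding a using L(1) by (metis Reals_mult Reals_of_nat of_nat_fact)
    moreover have "\<psi> z = a * z ^ n / (fact n * (1 - cnj c * z) powr of_real ?s)" if "z \<in> ball 0 1" for z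
      unfolding a psi[OF that] by simp
    ultimately show ?thesis
      using a b L(2) phi by simp
  qed
  have backward: "self_adjoint \<alpha> ?T"
    if psi: "\<And>z. z \<in> ball 0 1 \<Longrightarrow> \<psi> z = a * z ^ n / (fact n * (1 - cnj c * z) powr of_real ?s)"
      and phi: "\<And>z. z \<in> ball 0 1 \<Longrightarrow> \<phi> z = c + b * z / (1 - cnj c * z)"
      and ab: "a \<in> \<real>" "b \<in> \<real>"
  proof -
    have "a / fact n \<in> \<real>" using ab by (metis Reals_divide Reals_of_nat of_nat_fact)
    moreover have "\<psi> z = a / fact n * z ^ n / (1 - cnj c * z) powr of_real ?s" if "z \<in> ball 0 1" for z
      using psi[OF that] by simp
    ultimately show ?thesis
      unfolding sa_iff using symbols_symmetric[OF maps c _ ab(2) _ phi] by blast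
  qed
  \<comment> \<open>The condition \<open>\<mu> * c = cnj c\<close> is what makes the explicit
    symbols invariant. It covers both claims, with 1 as the rotation for \<open>c = 0\<close> and
    the square of the conjugate phase of \<open>c\<close> otherwise.\<close>
  have C_sym: "C_symmetric \<alpha> (rotation_op \<mu> \<circ> J_op) ?T"
    if sa: "self_adjoint \<alpha> ?T" and mu: "cmod \<mu> = 1" and mu_c: "\<mu> * c = cnj c" for \<mu>
  proof (rule C_symmetric_comp_diff_op[OF sa maps mu])
    fix z :: complex assume z: "z \<in> ball 0 1"
    let ?z = "cnj (\<mu> * z)"
    have z': "?z \<in> ball 0 1" using z mu by (simp add: norm_mult)
    have mu_mu: "cnj \<mu> * \<mu> = 1" using mu complex_norm_square[of \<mu>] by (simp add: mult.commute)
    have cz: "cnj (1 - cnj c * ?z) = 1 - cnj c * z"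
      using arg_cong[OF mu_c, of "\<lambda>x. x * z"] by (simp add: mult_ac)
    have ab: "cnj a = a" "cnj b = b" using forward[OF sa] by (simp_all add: Reals_cnj_iff)
    have mu_cc: "cnj \<mu> * cnj c = c"
      using arg_cong[OF mu_c, of cnj] by simp
    have "cnj ((1 - cnj c * ?z) powr of_real ?s) = (1 - cnj c * z) powr of_real ?s"
      using cnj_powr_of_real[OF Re_one_minus_cnj_mult_pos[OF c z'], of ?s] unfolding cz .
    moreover have "\<psi> ?z = a * ?z ^ n / (fact n * (1 - cnj c * ?z) powr of_real ?s)"
      using forward[OF sa] z' by blast
    ultimately have "cnj (\<mu> ^ n * \<psi> ?z)
        = (cnj \<mu> * \<mu>) ^ n * (a * z ^ n / (fact n * (1 - cnj c * z) powr of_real ?s))"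
      by (simp add: ab power_mult_distrib mult_ac)
    also have "\<dots> = \<psi> z" unfolding mu_mu using forward[OF sa] z by simp
    finally show "cnj (\<mu> ^ n * \<psi> ?z) = \<psi> z" .
    have "\<phi> ?z = c + b * ?z / (1 - cnj c * ?z)"
      using forward[OF sa] z' by blast
    then have "cnj (\<mu> * \<phi> ?z) = cnj \<mu> * (cnj c + b * (\<mu> * z) / (1 - cnj c * z))"
      using cz by (simp add: ab)
    also have "\<dots> = cnj \<mu> * cnj c + (cnj \<mu> * \<mu>) * (b * z / (1 - cnj c * z))"
      by (simp add: ring_distribs mult_ac)
    also have "\<dots> = \<phi> z" unfolding mu_mu mu_cc using forward[OF sa] z by simp
    finally show "cnj (\<mu> * \<phi> ?z) = \<phi> z" .
  qed
  have "C_symmetric \<alpha> J_op ?T" if "self_adjoint \<alpha> ?T" "c = 0"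
  proof -
    have "rotation_op 1 \<circ> J_op = J_op" by (simp add: rotation_op_def fun_eq_iff)
    then show ?thesis using C_sym[of 1] that by simp
  qed
  moreover have "C_symmetric \<alpha> (rotation_op (exp (- 2 * \<i> * of_real \<theta>)) \<circ> J_op) ?T"
    if "self_adjoint \<alpha> ?T"
  proof (rule C_sym[OF that])
    have "exp (- 2 * \<i> * of_real \<theta>) = cis (- 2 * \<theta>)"
      by (simp add: cis_conv_exp mult_ac)
    then show "cmod (exp (- 2 * \<i> * of_real \<theta>)) = 1" by simp
    \<comment> \<open>In polar form the rotation by minus twice the argument turns the phase of
      \<open>c\<close> into its conjugate.\<close>
    have ce: "c = of_real (cmod c) * exp (\<i> * of_real \<theta>)"
      unfolding assms(13) by (rule Arg2pi_eq)
    have "exp (- 2 * \<i> * of_real \<theta>) * c = of_real (cmod c) * (exp (- 2 * \<i> * of_real \<theta>) * exp (\<i> * of_real \<theta>))"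
      by (subst ce) (simp add: mult_ac)
    also have "\<dots> = of_real (cmod c) * exp (- (\<i> * of_real \<theta>))"
      by (simp flip: exp_add)
    also have "\<dots> = cnj c"
      by (subst (2) ce) (simp add: exp_cnj)
    finally show "exp (- 2 * \<i> * of_real \<theta>) * c = cnj c" .
  qed
  ultimately show ?thesis
    using forward backward c by (simp (no_asm) only: K cong: ball_cong) blast
qed

end
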